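(* Let $N>\zeta\ge0$ and $M\ge0$ be integers, $\beta\in(0,1)$ and $\tau>0$. Let $\{a_m^{(1)}\}_{m=0}^N$ be initial coefficients in the feasible set $\mathcal{A}_\tau$, and let $\{a_m^{(\mathrm{ite})}\}$ and $\{t^{(\mathrm{ite})}(k,l)\}$, $\mathrm{ite}=1,2,\dots$, be the sequences generated by the iterative refinement procedure (Algorithm 2) described in the context. Then the sequence $\{t^{(\mathrm{ite})}(k,l)\}$ converges, i.e. $$\lim_{\mathrm{ite}\to+\infty}t^{(\mathrm{ite})}(k,l)=t^*(k,l)<+\infty\quad\text{for all }k\in\{0,\dots,\zeta\},\ l\in\{0,\dots,M\},$$ and $\{t^*(k,l)\}$ lie on the Pareto optimal boundary of the multi-objective problem described in the context; that is, there exist no coefficients $\{\tilde a_m^*\}\in\mathcal{A}_\tau$ whose associated roots $\{\tilde t^*(k,l)\}$ strictly dominate $\{t^*(k,l)\}$, where strict domination means $\tilde t^*(k,l)\ge t^*(k,l)$ for all $k,l$ and $\tilde t^*(k',l')>t^*(k',l')$ for some $(k',l')$.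
   Context: For integers $0\le l\le M$ let $B_M(t;l)=\sum_{i=0}^l\binom{M}{i}t^i(1-t)^{M-i}$ (with $B_0(t;0)=1$). Feasible coefficients: $\mathcal{A}_\tau$ is the set of $(a_0,\dots,a_N)$ with $a_m\ge0$ for all $m$, $\sum_{m=0}^Na_m=1$ and $\sum_{m=\zeta}^{N-1}a_m\ge\tau$. Associated roots: for $a\in\mathcal{A}_\tau$, $k\in\{0,\dots,\zeta\}$, $l\in\{0,\dots,M\}$, the associated root $t(k,l)$ is the unique $t\in(0,1)$ with $$\beta\sum_{m=k}^Na_m\binom{m}{k}t^{m-N}=\binom{N}{k}B_M(1-t;l)$$ (existence and uniqueness in $(0,1)$ hold for every $a\in\mathcal{A}_\tau$). Multi-objective problem: simultaneously maximize all $t(k,l)$, $k\in\{0,\dots,\zeta\}$, $l\in\{0,\dots,M\}$, over $a\in\mathcal{A}_\tau$, where $t(k,l)\in(0,1)$ are the roots associated with $a$. Algorithm 2 (run indefinitely): given $a^{(\mathrm{ite})}$, (1) compute its associated roots $t^{(\mathrm{ite})}(k,l)$ for all $k,l$; (2) let $a^{(\mathrm{ite}+1)}$ be an optimal solution of the linear program, with $t(k,l)=t^{(\mathrm{ite})}(k,l)$, $$\max_{a'\in\mathcal{A}_\tau}\ \sum_{k=0}^{\zeta}\sum_{l=0}^M\sum_{m=k}^Na'_m\binom{m}{k}t(k,l)^{m-N}$$ $$\text{s.t.}\quad\beta\sum_{m=k}^Na'_m\binom{m}{k}t(k,l)^{m-N}\ge\binom{N}{k}B_M(1-t(k,l);l),\quad\forall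 k\in\{0,\dots,\zeta\},\ l\in\{0,\dots,M\};$$ (3) increase $\mathrm{ite}$ by one and repeat. *)

theory Defs
  imports Complex_Main
begin

definition bern_cdf :: "nat \<Rightarrow> real \<Rightarrow> nat \<Rightarrow> real" where
  "bern_cdf M t l = (\<Sum>i=0..l. real (M choose i) * t ^ i * (1 - t) ^ (M - i))"

text \<open>A coefficient vector \<open>(a\<^sub>0, \<dots>, a\<^sub>N)\<close> is a function on the naturals of which only
  the values at \<open>0, \<dots>, N\<close> are ever used.\<close>

definition feasible_coeffs :: "nat \<Rightarrow> nat \<Rightarrow> real \<Rightarrow> (nat \<Rightarrow> real) set" where
  "feasible_coeffs N \<zeta> \<tau> =
     {a. (\<forall>m\<le>N. 0 \<le> a m) \<and> (\<Sum>m=0..N. a m) = 1 \<and> (\<Sum>m=\<zeta>..N - 1. a m) \<ge> \<tau>}"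

text \<open>The exponent \<open>m - N\<close> is a nonpositive integer, hence the integer power.\<close>

definition weighted_sum :: "nat \<Rightarrow> (nat \<Rightarrow> real) \<Rightarrow> nat \<Rightarrow> real \<Rightarrow> real" where
  "weighted_sum N a k t =
     (\<Sum>m=k..N. a m * real (m choose k) * t powi (int m - int N))"

text \<open>For \<open>0 < \<beta> < 1\<close>, \<open>0 < \<tau>\<close>, feasible \<open>a\<close>, \<open>k \<le> \<zeta> < N\<close> and \<open>l \<le> M\<close> the description below is proper:
  the left-hand side decreases strictly from infinity at 0, the right-hand side is nondecreasing
  in \<open>t\<close> and is the larger one at \<open>t = 1\<close>.\<close>

definition assoc_root ::
  "nat \<Rightarrow> nat \<Rightarrow> real \<Rightarrow> (nat \<Rightarrow> real) \<Rightarrow> nat \<Rightarrow> nat \<Rightarrow> real" where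
  "assoc_root N M \<beta> a k l =
     (THE t. 0 < t \<and> t < 1 \<and>
        \<beta> * weighted_sum N a k t = real (N choose k) * bern_cdf M (1 - t) l)"

definition lp_objective ::
  "nat \<Rightarrow> nat \<Rightarrow> nat \<Rightarrow> (nat \<Rightarrow> nat \<Rightarrow> real) \<Rightarrow> (nat \<Rightarrow> real) \<Rightarrow> real" where
  "lp_objective N \<zeta> M t a = (\<Sum>k=0..\<zeta>. \<Sum>l=0..M. weighted_sum N a k (t k l))"

definition lp_feasible ::
  "nat \<Rightarrow> nat \<Rightarrow> nat \<Rightarrow> real \<Rightarrow> real \<Rightarrow> (nat \<Rightarrow> nat \<Rightarrow> real) \<Rightarrow> (nat \<Rightarrow> real) \<Rightarrow> bool" where
  "lp_feasible N \<zeta> M \<beta> \<tau> t a \<longleftrightarrow>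
     a \<in> feasible_coeffs N \<zeta> \<tau> \<and>
     (\<forall>k\<le>\<zeta>. \<forall>l\<le>M. \<beta> * weighted_sum N a k (t k l)
        \<ge> real (N choose k) * bern_cdf M (1 - t k l) l)"

text \<open>The iterations are numbered from 1; the entries at index 0 are irrelevant. The linear
  program may have several optimal solutions, so a run is a relation and not a function of the
  initial coefficients.\<close>

definition refinement_run ::
  "nat \<Rightarrow> nat \<Rightarrow> nat \<Rightarrow> real \<Rightarrow> real \<Rightarrow> (nat \<Rightarrow> nat \<Rightarrow> real) \<Rightarrow> (nat \<Rightarrow> nat \<Rightarrow> nat \<Rightarrow> real) \<Rightarrow> bool" where
  "refinement_run N \<zeta> M \<beta> \<tau> a t \<longleftrightarrow>
     (\<forall>ite\<ge>1.
        (\<forall>k\<le>\<zeta>. \<forall>l\<le>M. t ite k l = assoc_root N M \<beta> (a ite) k l) \<and>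
        is_arg_max (lp_objective N \<zeta> M (t ite)) (lp_feasible N \<zeta> M \<beta> \<tau> (t ite)) (a (Suc ite)))"

definition strictly_dominates ::
  "nat \<Rightarrow> nat \<Rightarrow> (nat \<Rightarrow> nat \<Rightarrow> real) \<Rightarrow> (nat \<Rightarrow> nat \<Rightarrow> real) \<Rightarrow> bool" where
  "strictly_dominates \<zeta> M s t \<longleftrightarrow>
     (\<forall>k\<le>\<zeta>. \<forall>l\<le>M. s k l \<ge> t k l) \<and> (\<exists>k\<le>\<zeta>. \<exists>l\<le>M. s k l > t k l)"

text \<open>Not strictly dominated by the roots of any feasible vector; \<open>t\<close> itself, which is going to
  be a limit, is not required to be the family of roots of a feasible vector.\<close>

definition pareto_optimal ::
  "nat \<Rightarrow> nat \<Rightarrow> nat \<Rightarrow> real \<Rightarrow> real \<Rightarrow> (nat \<Rightarrow> nat \<Rightarrow> real) \<Rightarrow> bool" where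
  "pareto_optimal N \<zeta> M \<beta> \<tau> t \<longleftrightarrow>
     \<not> (\<exists>a \<in> feasible_coeffs N \<zeta> \<tau>. strictly_dominates \<zeta> M (assoc_root N M \<beta> a) t)"

end

theory Submission
  imports Defs
begin

text \<open>The current vector satisfies all constraints of its own linear program with equality, so the
  roots increase along a run and converge to some \<open>t*\<close>. A feasible vector whose roots dominate
  \<open>t*\<close> is admissible in every one of these programs, so its objective value never exceeds the
  optimal one. Because the coefficients stay in \<open>[0, 1]\<close> and consecutive roots have the same
  limit, the optimal value tends to the sum of the right-hand sides of the root equations at \<open>t*\<close>
  (divided by \<open>\<beta>\<close>); the dominating vector would strictly exceed this in the limit.\<close>

section \<open>Binomial distribution functions: monotonicity and continuity in the success
  probability\<close>

lemma bern_cdf_eq_1: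
  assumes "M = 0 \<or> p = 0"
  shows "bern_cdf M p l = 1"
proof -
  have "bern_cdf M p l = (\<Sum>i=0..l. if i = 0 then 1 else 0)"
    unfolding bern_cdf_def using assms by (intro sum.cong) auto
  then show ?thesis by simp
qed

text \<open>Conditioning on the last of \<open>Suc M\<close> trials: a failure leaves room for
  \<open>Suc l\<close> successes among the others, a success only for \<open>l\<close>. Formally
  this is Pascal's rule, term by term.\<close>

lemma bern_cdf_Suc_Suc:
  "bern_cdf (Suc M) p (Suc l) = (1 - p) * bern_cdf M p (Suc l) + p * bern_cdf M p l"
proof (induction l)
  case 0
  show ?case by (cases M) (auto simp: bern_cdf_def algebra_simps)
next
  case (Suc l)
  have "real (Suc M choose Suc (Suc l)) * p ^ Suc (Suc l) * (1 - p) ^ (Suc M - Suc (Suc l))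
      = (1 - p) * (real (M choose Suc (Suc l)) * p ^ Suc (Suc l) * (1 - p) ^ (M - Suc (Suc l)))
        + p * (real (M choose Suc l) * p ^ Suc l * (1 - p) ^ (M - Suc l))"
  \<comment> \<open>For \<open>Suc (Suc l) > M\<close> the truncated exponent cannot absorb the
    factor \<open>1 - p\<close>, but then \<open>M choose Suc (Suc l)\<close> is zero.\<close>
  proof (cases "Suc (Suc l) \<le> M")
    case True
    then have "M - Suc l = Suc (M - Suc (Suc l))" by simp
    then show ?thesis by (simp add: algebra_simps)
  qed (simp add: algebra_simps)
  with Suc show ?case by (simp add: bern_cdf_def algebra_simps)
qed

text \<open>A higher success probability makes few successes less likely. The recursion writes both
  sides as convex combinations, so induction on \<open>M\<close> avoids differentiating in
  \<open>p\<close>.\<close>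

lemma bern_cdf_antimono:
  assumes "0 \<le> p" "p \<le> q" "q \<le> 1"
  shows "bern_cdf M q l \<le> bern_cdf M p l"
proof (induction M arbitrary: l)
  case 0
  show ?case by (simp add: bern_cdf_eq_1)
next
  case (Suc M)
  show ?case
  proof (cases l)
    case 0
    then show ?thesis using assms power_mono[of "1 - q" "1 - p" "Suc M"]
      by (simp add: bern_cdf_def)
  next
    case (Suc l')
    have le: "bern_cdf M p l' \<le> bern_cdf M p (Suc l')"
      using assms by (simp add: bern_cdf_def)
    have "(1 - q) * bern_cdf M q (Suc l') + q * bern_cdf M q l'
        \<le> (1 - q) * bern_cdf M p (Suc l') + q * bern_cdf M p l'"
      using assms by (intro add_mono mult_left_mono Suc.IH) auto
    \<comment> \<open>Passing from \<open>q\<close> to \<open>p\<close> moves weight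
      \<open>q - p\<close> from the smaller value, at \<open>l'\<close>, to the larger one, at
      \<open>Suc l'\<close>.\<close>
    also have "\<dots> \<le> (1 - p) * bern_cdf M p (Suc l') + p * bern_cdf M p l'"
      using mult_right_mono[OF \<open>p \<le> q\<close>, of "bern_cdf M p (Suc l') - bern_cdf M p l'"] le
      by (simp add: algebra_simps)
    finally show ?thesis by (simp add: Suc bern_cdf_Suc_Suc)
  qed
qed

lemma continuous_on_bern_cdf [continuous_intros]:
  "continuous_on S f \<Longrightarrow> continuous_on S (\<lambda>x. bern_cdf M (f x) l)"
  unfolding bern_cdf_def by (intro continuous_intros)

lemma tendsto_bern_cdf [tendsto_intros]:
  "(f \<longlongrightarrow> p) F \<Longrightarrow> ((\<lambda>x. bern_cdf M (f x) l) \<longlongrightarrow> bern_cdf M p l) F"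
  unfolding bern_cdf_def by (intro tendsto_intros)

section \<open>Weighted sums with feasible coefficients\<close>

lemma weighted_sum_inverse:
  "weighted_sum N a k t = (\<Sum>m=k..N. a m * real (m choose k) * inverse t ^ (N - m))"
  unfolding weighted_sum_def
proof (rule sum.cong[OF refl])
  fix m assume "m \<in> {k..N}"
  then have "int m - int N = - int (N - m)" by auto
  then have "t powi (int m - int N) = inverse t ^ (N - m)"
    by (simp only: power_int_minus power_int_of_nat power_inverse)
  then show "a m * real (m choose k) * t powi (int m - int N)
      = a m * real (m choose k) * inverse t ^ (N - m)" by simp
qed

lemma feasible_coeffsD:
  assumes "a \<in> feasible_coeffs N \<zeta> \<tau>" "m \<le> N"
  shows "0 \<le> a m" "a m \<le> 1"
proof -
  show "0 \<le> a m" using assms by (auto simp: feasible_coeffs_def)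
  have "a m \<le> (\<Sum>m=0..N. a m)"
    using assms by (intro member_le_sum) (auto simp: feasible_coeffs_def)
  then show "a m \<le> 1" using assms by (auto simp: feasible_coeffs_def)
qed

text \<open>Supplies a term that really depends on \<open>t\<close>: \<open>m < N\<close> makes its
  exponent negative, and \<open>\<zeta> \<le> m\<close> makes \<open>m choose k\<close> positive for
  all \<open>k \<le> \<zeta>\<close>.\<close>

lemma feasible_coeffs_pos_coeff:
  assumes "a \<in> feasible_coeffs N \<zeta> \<tau>" "0 < \<tau>" "\<zeta> < N"
  obtains m where "\<zeta> \<le> m" "m < N" "0 < a m"
proof -
  have "0 < (\<Sum>m=\<zeta>..N - 1. a m)" using assms by (auto simp: feasible_coeffs_def)
  then obtain m where "m \<in> {\<zeta>..N - 1}" "0 < a m"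
    by (meson not_le sum_nonpos)
  with assms that show thesis by auto
qed

lemma weighted_sum_strict_antimono:
  assumes a: "a \<in> feasible_coeffs N \<zeta> \<tau>" and "0 < \<tau>" "\<zeta> < N" "k \<le> \<zeta>" "0 < s" "s < t"
  shows "weighted_sum N a k t < weighted_sum N a k s"
  unfolding weighted_sum_inverse
proof (rule sum_strict_mono_ex1)
  have inv: "inverse t < inverse s" "0 < inverse t" using assms by simp_all
  show "\<forall>m\<in>{k..N}. a m * real (m choose k) * inverse t ^ (N - m)
      \<le> a m * real (m choose k) * inverse s ^ (N - m)"
    using inv feasible_coeffsD[OF a] by (intro ballI mult_left_mono power_mono) auto
  obtain m where m: "\<zeta> \<le> m" "m < N" "0 < a m"
    using feasible_coeffs_pos_coeff[OF a \<open>0 < \<tau>\<close> \<open>\<zeta> < N\<close>] .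
  show "\<exists>m\<in>{k..N}. a m * real (m choose k) * inverse t ^ (N - m)
      < a m * real (m choose k) * inverse s ^ (N - m)"
    using m inv \<open>k \<le> \<zeta>\<close>
    by (intro bexI[of _ m] mult_strict_left_mono power_strict_mono) auto
qed simp

text \<open>At 1 the powers disappear, \<open>m choose k\<close> is at most
  \<open>N choose k\<close>, and the coefficients sum to 1.\<close>

lemma weighted_sum_1_le:
  assumes a: "a \<in> feasible_coeffs N \<zeta> \<tau>"
  shows "weighted_sum N a k 1 \<le> real (N choose k)"
proof -
  have "weighted_sum N a k 1 = (\<Sum>m=k..N. a m * real (m choose k))"
    by (simp add: weighted_sum_inverse)
  also have "\<dots> \<le> (\<Sum>m=k..N. a m * real (N choose k))"
    using feasible_coeffsD[OF a] by (intro sum_mono mult_left_mono) (auto intro: binomial_right_mono)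
  also have "\<dots> \<le> (\<Sum>m=0..N. a m * real (N choose k))"
    using feasible_coeffsD[OF a] by (intro sum_mono2) auto
  also have "\<dots> = real (N choose k)"
    using a by (simp add: sum_distrib_right[symmetric] feasible_coeffs_def)
  finally show ?thesis .
qed

text \<open>Makes the blow-up at 0 explicit: the exponent \<open>N - m\<close> is at least 1, so a
  single term already gives this bound.\<close>

lemma weighted_sum_ge_term:
  assumes a: "a \<in> feasible_coeffs N \<zeta> \<tau>" and "k \<le> m" "m < N" "0 < t" "t \<le> 1"
  shows "a m / t \<le> weighted_sum N a k t"
proof -
  have "1 \<le> real (m choose k)" using \<open>k \<le> m\<close> by (simp add: Suc_leI)
  moreover have "inverse t \<le> inverse t ^ (N - m)"
    using power_increasing[of 1 "N - m" "inverse t"] assms by (simp add: one_le_inverse)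
  ultimately have "1 * inverse t \<le> real (m choose k) * inverse t ^ (N - m)"
    using \<open>0 < t\<close> by (intro mult_mono) auto
  then have "a m / t \<le> a m * real (m choose k) * inverse t ^ (N - m)"
    using mult_left_mono[of "inverse t" _ "a m"] feasible_coeffsD(1)[OF a, of m] \<open>m < N\<close>
    by (simp add: divide_inverse mult.assoc)
  also have "\<dots> \<le> weighted_sum N a k t"
    unfolding weighted_sum_inverse
    using feasible_coeffsD(1)[OF a] assms
    by (intro member_le_sum[where f = "\<lambda>m. a m * real (m choose k) * inverse t ^ (N - m)"]) auto
  finally show ?thesis .
qed

section \<open>Existence, uniqueness and location of the associated roots\<close>

definition root_defect ::
  "nat \<Rightarrow> nat \<Rightarrow> real \<Rightarrow> (nat \<Rightarrow> real) \<Rightarrow> nat \<Rightarrow> nat \<Rightarrow> real \<Rightarrow> real" where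
  "root_defect N M \<beta> a k l t =
     \<beta> * weighted_sum N a k t - real (N choose k) * bern_cdf M (1 - t) l"

context
  fixes N \<zeta> M :: nat and \<beta> \<tau> :: real
  assumes \<zeta>: "\<zeta> < N" and \<beta>: "0 < \<beta>" "\<beta> < 1" and \<tau>: "0 < \<tau>"
begin

text \<open>The weighted sum decreases strictly, while \<open>bern_cdf M (1 - t) l\<close> cannot
  decrease as \<open>t\<close> grows.\<close>

lemma root_defect_strict_antimono:
  assumes "a \<in> feasible_coeffs N \<zeta> \<tau>" "k \<le> \<zeta>" "0 < s" "s < t" "t \<le> 1"
  shows "root_defect N M \<beta> a k l t < root_defect N M \<beta> a k l s"
proof -
  have "real (N choose k) * bern_cdf M (1 - s) l \<le> real (N choose k) * bern_cdf M (1 - t) l"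
    using assms by (intro mult_left_mono bern_cdf_antimono) auto
  moreover have "\<beta> * weighted_sum N a k t < \<beta> * weighted_sum N a k s"
    using assms \<beta> \<zeta>
    by (intro mult_strict_left_mono weighted_sum_strict_antimono[OF _ \<tau>]) auto
  ultimately show ?thesis by (simp add: root_defect_def)
qed

lemma root_defect_1_neg:
  assumes "a \<in> feasible_coeffs N \<zeta> \<tau>" "k \<le> \<zeta>"
  shows "root_defect N M \<beta> a k l 1 < 0"
proof -
  have "\<beta> * weighted_sum N a k 1 \<le> \<beta> * real (N choose k)"
    using \<beta> weighted_sum_1_le[OF assms(1)] by (intro mult_left_mono) auto
  also have "\<dots> < real (N choose k)" using \<beta> \<zeta> assms by simp
  finally show ?thesis by (simp add: root_defect_def bern_cdf_eq_1)
qed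

text \<open>Intermediate value theorem on \<open>{e..1}\<close>: the defect is nonnegative at a
  suitable \<open>e > 0\<close> and negative at 1.\<close>

lemma ex_root_defect_zero:
  assumes a: "a \<in> feasible_coeffs N \<zeta> \<tau>" and "k \<le> \<zeta>"
  shows "\<exists>t. 0 < t \<and> t < 1 \<and> root_defect N M \<beta> a k l t = 0"
proof -
  obtain m where m: "\<zeta> \<le> m" "m < N" "0 < a m"
    using feasible_coeffs_pos_coeff[OF a \<tau> \<zeta>] .
  have C: "1 \<le> real (N choose k)" using \<zeta> \<open>k \<le> \<zeta>\<close> by (simp add: Suc_leI)
  \<comment> \<open>Chosen so that the lower bound \<open>\<beta> * (a m / e)\<close> for the
    left-hand side equals \<open>N choose k\<close>, the largest value that the right-hand side can
    take.\<close>
  define e where "e = \<beta> * a m / real (N choose k)"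
  have e0: "0 < e" using m \<beta> \<open>k \<le> \<zeta>\<close> unfolding e_def by (intro divide_pos_pos mult_pos_pos) auto
  have "\<beta> * a m \<le> 1 * 1"
    using \<beta> m feasible_coeffsD[OF a, of m] by (intro mult_mono) auto
  then have e1: "e \<le> 1" using C by (simp add: e_def divide_le_eq)
  have "real (N choose k) * bern_cdf M (1 - e) l \<le> real (N choose k) * bern_cdf M 0 l"
    using e0 e1 by (intro mult_left_mono bern_cdf_antimono) auto
  also have "\<dots> = \<beta> * (a m / e)" using C m \<beta> by (simp add: bern_cdf_eq_1 e_def)
  also have "\<dots> \<le> \<beta> * weighted_sum N a k e"
    using \<beta> m e0 e1 \<open>k \<le> \<zeta>\<close> by (intro mult_left_mono weighted_sum_ge_term[OF a]) auto
  finally have ge: "0 \<le> root_defect N M \<beta> a k l e" by (simp add: root_defect_def)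
  have "continuous_on {e..1} (root_defect N M \<beta> a k l)"
    unfolding root_defect_def weighted_sum_inverse using e0
    by (intro continuous_intros) auto
  then obtain t where "e \<le> t" "t \<le> 1" "root_defect N M \<beta> a k l t = 0"
    using IVT2'[of "root_defect N M \<beta> a k l" 1 0 e] root_defect_1_neg[OF a \<open>k \<le> \<zeta>\<close>, of l] ge e1
    by auto
  moreover from this have "t \<noteq> 1" using root_defect_1_neg[OF a \<open>k \<le> \<zeta>\<close>, of l] by auto
  ultimately show ?thesis using e0 by (intro exI[of _ t]) auto
qed

lemma assoc_root:
  assumes a: "a \<in> feasible_coeffs N \<zeta> \<tau>" and "k \<le> \<zeta>"
  shows "0 < assoc_root N M \<beta> a k l" "assoc_root N M \<beta> a k l < 1"
    "root_defect N M \<beta> a k l (assoc_root N M \<beta> a k l) = 0"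
proof -
  obtain t where "0 < t \<and> t < 1 \<and> root_defect N M \<beta> a k l t = 0"
    using ex_root_defect_zero[OF assms] by blast
  moreover have "s = t'" if "0 < s \<and> s < 1 \<and> root_defect N M \<beta> a k l s = 0"
    "0 < t' \<and> t' < 1 \<and> root_defect N M \<beta> a k l t' = 0" for s t'
    using root_defect_strict_antimono[OF assms, of s t' l]
      root_defect_strict_antimono[OF assms, of t' s l] that
    by (cases s t' rule: linorder_cases) auto
  ultimately have "\<exists>!t. 0 < t \<and> t < 1 \<and> root_defect N M \<beta> a k l t = 0"
    by blast
  from theI'[OF this] show "0 < assoc_root N M \<beta> a k l" "assoc_root N M \<beta> a k l < 1"
    "root_defect N M \<beta> a k l (assoc_root N M \<beta> a k l) = 0"
    by (simp_all add: assoc_root_def root_defect_def)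
qed

text \<open>The defect is strictly decreasing and vanishes at the root, so its sign at
  \<open>s\<close> tells on which side of the root \<open>s\<close> lies.\<close>

lemma root_defect_nonneg_iff:
  assumes "a \<in> feasible_coeffs N \<zeta> \<tau>" "k \<le> \<zeta>" "0 < s" "s \<le> 1"
  shows "0 \<le> root_defect N M \<beta> a k l s \<longleftrightarrow> s \<le> assoc_root N M \<beta> a k l"
  using root_defect_strict_antimono[OF assms(1,2), of s "assoc_root N M \<beta> a k l" l]
    root_defect_strict_antimono[OF assms(1,2), of "assoc_root N M \<beta> a k l" s l]
    assoc_root[OF assms(1,2), of l] assms(3,4)
  by (cases s "assoc_root N M \<beta> a k l" rule: linorder_cases) auto

text \<open>Each linear constraint says that a defect is nonnegative at \<open>t k l\<close>. Hence
  a feasible vector is admissible exactly when its roots are no worse than the given ones.\<close>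

lemma lp_feasible_iff_le_assoc_root:
  assumes "\<And>k l. k \<le> \<zeta> \<Longrightarrow> l \<le> M \<Longrightarrow> 0 < t k l \<and> t k l \<le> 1"
  shows "lp_feasible N \<zeta> M \<beta> \<tau> t a \<longleftrightarrow> a \<in> feasible_coeffs N \<zeta> \<tau> \<and>
    (\<forall>k\<le>\<zeta>. \<forall>l\<le>M. t k l \<le> assoc_root N M \<beta> a k l)"
  using assms by (auto simp: lp_feasible_def root_defect_def simp flip: root_defect_nonneg_iff)

end

text \<open>The coefficients need not converge, but they are bounded.\<close>

lemma weighted_sum_diff_tendsto_0:
  assumes a: "\<And>n. a n \<in> feasible_coeffs N \<zeta> \<tau>"
    and s: "s \<longlonglongrightarrow> c" and t: "t \<longlonglongrightarrow> c" and c: "c \<noteq> 0"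
  shows "(\<lambda>n. weighted_sum N (a n) k (s n) - weighted_sum N (a n) k (t n)) \<longlonglongrightarrow> 0"
proof -
  have "(\<lambda>n. \<Sum>m=k..N. a n m * (real (m choose k) *
      (inverse (s n) ^ (N - m) - inverse (t n) ^ (N - m)))) \<longlonglongrightarrow> 0"
  proof (rule tendsto_null_sum)
    fix m assume m: "m \<in> {k..N}"
    have "(\<lambda>n. real (m choose k) * (inverse (s n) ^ (N - m) - inverse (t n) ^ (N - m)))
        \<longlonglongrightarrow> real (m choose k) * (inverse c ^ (N - m) - inverse c ^ (N - m))"
      using c by (intro tendsto_intros s t)
    then have null: "(\<lambda>n. real (m choose k) * (inverse (s n) ^ (N - m) - inverse (t n) ^ (N - m)))
        \<longlonglongrightarrow> 0" by simp
    show "(\<lambda>n. a n m * (real (m choose k) *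
        (inverse (s n) ^ (N - m) - inverse (t n) ^ (N - m)))) \<longlonglongrightarrow> 0"
    \<comment> \<open>The factor \<open>a n m\<close> lies in \<open>[0, 1]\<close>, so it cannot
      enlarge the null sequence.\<close>
    proof (rule tendsto_0_le[OF null, where K = 1])
      show "\<forall>\<^sub>F n in sequentially. norm (a n m * (real (m choose k) *
          (inverse (s n) ^ (N - m) - inverse (t n) ^ (N - m))))
        \<le> norm (real (m choose k) * (inverse (s n) ^ (N - m) - inverse (t n) ^ (N - m))) * 1"
        using feasible_coeffsD[OF a, of m] m
        by (intro always_eventually allI) (simp add: abs_mult mult_left_le_one_le)
    qed
  qed
  then show ?thesis
    by (simp add: weighted_sum_inverse sum_subtractf algebra_simps)
qed

theorem theorem9:
  fixes N \<zeta> M :: nat and \<beta> \<tau> :: real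
    and a :: "nat \<Rightarrow> nat \<Rightarrow> real" and t :: "nat \<Rightarrow> nat \<Rightarrow> nat \<Rightarrow> real"
  assumes "\<zeta> < N"
    and "0 < \<beta>" and "\<beta> < 1" and "0 < \<tau>"
    and "a 1 \<in> feasible_coeffs N \<zeta> \<tau>"
    and "refinement_run N \<zeta> M \<beta> \<tau> a t"
  shows "\<exists>t_star :: nat \<Rightarrow> nat \<Rightarrow> real.
           (\<forall>k\<le>\<zeta>. \<forall>l\<le>M. (\<lambda>ite. t ite k l) \<longlonglongrightarrow> t_star k l) \<and>
           pareto_optimal N \<zeta> M \<beta> \<tau> t_star"
proof -
  note root = assoc_root[OF assms(1-4)]
  note lp_iff = lp_feasible_iff_le_assoc_root[OF assms(1-4)]
  \<comment> \<open>Shifts the numbering to start at 0, since a run says nothing about index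
    0.\<close>
  define b where "b n = a (Suc n)" for n
  define r where "r n = assoc_root N M \<beta> (b n)" for n
  have t_eq: "t (Suc n) k l = r n k l" if "k \<le> \<zeta>" "l \<le> M" for n k l
    using assms(6) that by (auto simp: refinement_run_def b_def r_def)
  have max: "is_arg_max (lp_objective N \<zeta> M (t (Suc n)))
      (lp_feasible N \<zeta> M \<beta> \<tau> (t (Suc n))) (b (Suc n))" for n
    using assms(6) by (auto simp: refinement_run_def b_def)
  have b: "b n \<in> feasible_coeffs N \<zeta> \<tau>" for n
  proof (cases n)
    case 0
    then show ?thesis using assms(5) by (simp add: b_def)
  next
    case (Suc n')
    then show ?thesis using max[of n'] by (auto simp: is_arg_max_def lp_feasible_def)
  qed
  have r: "0 < r n k l" "r n k l < 1" "root_defect N M \<beta> (b n) k l (r n k l) = 0"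
    if "k \<le> \<zeta>" for n k l
    using root[OF b that] by (simp_all add: r_def)
  have lp_iff': "lp_feasible N \<zeta> M \<beta> \<tau> (t (Suc n)) c \<longleftrightarrow> c \<in> feasible_coeffs N \<zeta> \<tau> \<and>
      (\<forall>k\<le>\<zeta>. \<forall>l\<le>M. r n k l \<le> assoc_root N M \<beta> c k l)" for n c
    using r by (subst lp_iff) (auto simp: t_eq less_imp_le)
  \<comment> \<open>Only admissibility of the new vector matters here; its optimality enters when
    the objectives are compared.\<close>
  have step: "r n k l \<le> r (Suc n) k l" if "k \<le> \<zeta>" "l \<le> M" for n k l
    using max[of n] that by (auto simp: is_arg_max_def lp_iff' r_def)
  define t_star where "t_star k l = (SUP n. r n k l)" for k l
  have lim: "(\<lambda>n. r n k l) \<longlonglongrightarrow> t_star k l" and le_lim: "r n k l \<le> t_star k l"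
    if "k \<le> \<zeta>" "l \<le> M" for n k l
  proof -
    have bdd: "bdd_above (range (\<lambda>n. r n k l))"
      using r(2)[OF that(1)] by (intro bdd_aboveI2[of _ _ 1]) (auto intro: less_imp_le)
    show "(\<lambda>n. r n k l) \<longlonglongrightarrow> t_star k l"
      unfolding t_star_def using step[OF that] bdd
      by (intro LIMSEQ_incseq_SUP) (auto simp: incseq_Suc_iff)
    show "r n k l \<le> t_star k l"
      unfolding t_star_def by (rule cSUP_upper[OF _ bdd]) simp
  qed
  \<comment> \<open>Keeps the limit away from the pole of the weighted sums at 0.\<close>
  have pos: "0 < t_star k l" if "k \<le> \<zeta>" "l \<le> M" for k l
    using r(1)[OF that(1), of 0 l] le_lim[OF that, of 0] by simp
  have conv: "(\<lambda>n. t n k l) \<longlonglongrightarrow> t_star k l" if "k \<le> \<zeta>" "l \<le> M" for k l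
    using lim[OF that] by (subst filterlim_sequentially_Suc[symmetric]) (simp add: t_eq that)

  define rhs where "rhs k l = real (N choose k) * bern_cdf M (1 - t_star k l) l / \<beta>" for k l
  \<comment> \<open>The objective pairs new coefficients with old roots. At the new roots the root
    equation gives the value, and replacing new roots by old ones changes it by a null
    sequence.\<close>
  have opt: "(\<lambda>n. weighted_sum N (b (Suc n)) k (r n k l)) \<longlonglongrightarrow> rhs k l"
    if "k \<le> \<zeta>" "l \<le> M" for k l
  proof -
    have lim': "(\<lambda>n. r (Suc n) k l) \<longlonglongrightarrow> t_star k l"
      using lim[OF that] by (rule LIMSEQ_Suc)
    have "weighted_sum N (b (Suc n)) k (r (Suc n) k l)
        = real (N choose k) * bern_cdf M (1 - r (Suc n) k l) l / \<beta>" for n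
      using r(3)[OF that(1), of "Suc n" l] assms(2) by (simp add: root_defect_def field_simps)
    then have "(\<lambda>n. weighted_sum N (b (Suc n)) k (r (Suc n) k l)) \<longlonglongrightarrow> rhs k l"
      unfolding rhs_def using assms(2) by (simp, intro tendsto_intros lim') auto
    moreover have "(\<lambda>n. weighted_sum N (b (Suc n)) k (r n k l)
        - weighted_sum N (b (Suc n)) k (r (Suc n) k l)) \<longlonglongrightarrow> 0"
      using pos[OF that] by (intro weighted_sum_diff_tendsto_0[OF b lim[OF that] lim']) auto
    ultimately show ?thesis by (auto dest: tendsto_add)
  qed

  have "\<not> strictly_dominates \<zeta> M (assoc_root N M \<beta> c) t_star"
    if c: "c \<in> feasible_coeffs N \<zeta> \<tau>" for c
  proof
    assume "strictly_dominates \<zeta> M (assoc_root N M \<beta> c) t_star"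
    then obtain k' l' where dom: "\<And>k l. k \<le> \<zeta> \<Longrightarrow> l \<le> M \<Longrightarrow> t_star k l \<le> assoc_root N M \<beta> c k l"
      and k'l': "k' \<le> \<zeta>" "l' \<le> M" "t_star k' l' < assoc_root N M \<beta> c k' l'"
      by (auto simp: strictly_dominates_def)
    have obj: "lp_objective N \<zeta> M (t (Suc n)) d
        = (\<Sum>k=0..\<zeta>. \<Sum>l=0..M. weighted_sum N d k (r n k l))" for n d
      unfolding lp_objective_def by (intro sum.cong refl) (auto simp: t_eq)
    \<comment> \<open>The roots of \<open>c\<close> lie above \<open>t_star\<close>, hence above
      every iterate.\<close>
    have "lp_feasible N \<zeta> M \<beta> \<tau> (t (Suc n)) c" for n
      using c by (auto simp: lp_iff' intro: order_trans[OF le_lim dom])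
    then have "lp_objective N \<zeta> M (t (Suc n)) c \<le> lp_objective N \<zeta> M (t (Suc n)) (b (Suc n))" for n
      using max[of n] by (auto simp: is_arg_max_linorder)
    then have le: "(\<Sum>k=0..\<zeta>. \<Sum>l=0..M. weighted_sum N c k (r n k l))
        \<le> (\<Sum>k=0..\<zeta>. \<Sum>l=0..M. weighted_sum N (b (Suc n)) k (r n k l))" for n
      by (simp add: obj)
    have "(\<lambda>n. \<Sum>k=0..\<zeta>. \<Sum>l=0..M. weighted_sum N (b (Suc n)) k (r n k l))
        \<longlonglongrightarrow> (\<Sum>k=0..\<zeta>. \<Sum>l=0..M. rhs k l)"
      by (intro tendsto_sum opt) auto
    moreover have "(\<lambda>n. \<Sum>k=0..\<zeta>. \<Sum>l=0..M. weighted_sum N c k (r n k l))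
        \<longlonglongrightarrow> (\<Sum>k=0..\<zeta>. \<Sum>l=0..M. weighted_sum N c k (t_star k l))"
    proof (intro tendsto_sum)
      fix k l assume "k \<in> {0..\<zeta>}" "l \<in> {0..M}"
      then have "k \<le> \<zeta>" "l \<le> M" by auto
      then show "(\<lambda>n. weighted_sum N c k (r n k l)) \<longlonglongrightarrow> weighted_sum N c k (t_star k l)"
        unfolding weighted_sum_inverse using pos[of k l]
        by (intro tendsto_intros lim) auto
    qed
    ultimately have "(\<Sum>k=0..\<zeta>. \<Sum>l=0..M. weighted_sum N c k (t_star k l))
        \<le> (\<Sum>k=0..\<zeta>. \<Sum>l=0..M. rhs k l)"
      using le by (intro LIMSEQ_le) auto
    \<comment> \<open>Opposes the limit inequality: the defect of \<open>c\<close> at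
      \<open>t_star\<close> is nonnegative for every pair and positive at \<open>k'\<close>,
      \<open>l'\<close>, where domination is strict.\<close>
    moreover have "(\<Sum>k=0..\<zeta>. \<Sum>l=0..M. rhs k l)
        < (\<Sum>k=0..\<zeta>. \<Sum>l=0..M. weighted_sum N c k (t_star k l))"
    proof -
      have weak: "rhs k l \<le> weighted_sum N c k (t_star k l)" if "k \<le> \<zeta>" "l \<le> M" for k l
      proof -
        have "0 \<le> root_defect N M \<beta> c k l (t_star k l)"
          using dom[OF that] pos[OF that] root(2)[OF c that(1), of M l]
          by (subst root_defect_nonneg_iff[OF assms(1-4) c that(1)]) auto
        then show ?thesis using assms(2) by (simp add: root_defect_def rhs_def field_simps)
      qed
      have "0 < root_defect N M \<beta> c k' l' (t_star k' l')"
        using root_defect_strict_antimono[OF assms(1-4) c k'l'(1) pos[OF k'l'(1,2)] k'l'(3), of M l']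
          root[OF c k'l'(1), of M l'] by simp
      then have strict: "rhs k' l' < weighted_sum N c k' (t_star k' l')"
        using assms(2) by (simp add: root_defect_def rhs_def field_simps)
      have "(\<Sum>l=0..M. rhs k' l) < (\<Sum>l=0..M. weighted_sum N c k' (t_star k' l))"
        using weak strict k'l' by (intro sum_strict_mono_ex1) auto
      then show ?thesis
        using weak k'l'(1) by (intro sum_strict_mono_ex1) (auto intro!: sum_mono)
    qed
    ultimately show False by simp
  qed
  with conv show ?thesis
    by (intro exI[of _ t_star]) (auto simp: pareto_optimal_def)
qed

end
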